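(* Let $(\mathbf{A},\mathbf{B},\mathbf{C})$ and $(\widehat{\mathbf{A}},\widehat{\mathbf{B}},\widehat{\mathbf{C}})$ be two stabilizable and detectable linear time-invariant systems, with $\mathbf{A}\in\mathbb{R}^{n\times n}$, $\mathbf{B}\in\mathbb{R}^{n\times m}$, $\mathbf{C}\in\mathbb{R}^{p\times n}$, $\widehat{\mathbf{A}}\in\mathbb{R}^{r\times r}$, $\widehat{\mathbf{B}}\in\mathbb{R}^{r\times m}$, $\widehat{\mathbf{C}}\in\mathbb{R}^{p\times r}$, such that $\sigma(\mathbf{A})\cap \imath\mathbb{R}=\emptyset=\sigma(\widehat{\mathbf{A}})\cap\imath\mathbb{R}$. Let $\mathbf{G},\widehat{\mathbf{G}}$ be their transfer functions and let $\mathbf{G}_{\mathbf{F}}=[\mathbf{M},\mathbf{N}]$ and $\widehat{\mathbf{G}}_{\mathbf{F}}=[\widehat{\mathbf{M}},\widehat{\mathbf{N}}]$ be the left-coprime factorizations (defined in the context) with $\mathbf{F}=\mathbf{P}\mathbf{C}^T$ and $\widehat{\mathbf{F}}=\widehat{\mathbf{P}}\widehat{\mathbf{C}}^T$. Then $$\|\mathbf{G}-\widehat{\mathbf{G}}\|_{\mathcal{L}_2}\le \|\widehat{\mathbf{M}}^{-1}\|_{\mathcal{L}_\infty}\left(\|\mathbf{G}\|_{\mathcal{L}_\infty}\|\mathbf{M}-\widehat{\mathbf{M}}\|_{\mathcal{H}_2}+\|\mathbf{N}-\widehat{\mathbf{N}}\|_{\mathcal{H}_2}\right),$$ and, thus,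 $$\|\mathbf{G}-\widehat{\mathbf{G}}\|_{\mathcal{L}_2}\le \|\widehat{\mathbf{M}}^{-1}\|_{\mathcal{L}_\infty}\left(1+\|\mathbf{G}\|_{\mathcal{L}_\infty}\right)\|\mathbf{G}-\widehat{\mathbf{G}}\|_{\mathcal{H}_2\text{-gap}}.$$
   Context: $\sigma(\cdot)$ denotes the spectrum of a matrix. The transfer functions are $\mathbf{G}(s)=\mathbf{C}(s\mathbf{I}-\mathbf{A})^{-1}\mathbf{B}$ and $\widehat{\mathbf{G}}(s)=\widehat{\mathbf{C}}(s\mathbf{I}-\widehat{\mathbf{A}})^{-1}\widehat{\mathbf{B}}$. "Stabilizable and detectable" means $(\mathbf{A},\mathbf{B})$ is stabilizable and $(\mathbf{A},\mathbf{C})$ is detectable. Let $\mathbf{P}=\mathbf{P}^T\succeq 0$ be the solution of the algebraic Riccati equation $\mathbf{A}\mathbf{P}+\mathbf{P}\mathbf{A}^T-\mathbf{P}\mathbf{C}^T\mathbf{C}\mathbf{P}+\mathbf{B}\mathbf{B}^T=0$, $\mathbf{F}=\mathbf{P}\mathbf{C}^T$, and $\mathbf{A}_{\mathbf{F}}=\mathbf{A}-\mathbf{F}\mathbf{C}$ (asymptotically stable under the stabilizability/detectability assumption). The left-coprime factors are $$\mathbf{M}(s)=\mathbf{I}-\mathbf{C}(s\mathbf{I}-\mathbf{A}_{\mathbf{F}})^{-1}\mathbf{F},\qquad \mathbf{N}(s)=\mathbf{C}(s\mathbf{I}-\mathbf{A}_{\mathbf{F}})^{-1}\mathbf{B},$$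 so that $\mathbf{G}(s)=[\mathbf{M}(s)]^{-1}\mathbf{N}(s)$ and $[\mathbf{M}(s)]^{-1}=\mathbf{I}+\mathbf{C}(s\mathbf{I}-\mathbf{A})^{-1}\mathbf{F}$. The quantities $\widehat{\mathbf{P}},\widehat{\mathbf{F}}=\widehat{\mathbf{P}}\widehat{\mathbf{C}}^T,\widehat{\mathbf{A}}_{\widehat{\mathbf{F}}}=\widehat{\mathbf{A}}-\widehat{\mathbf{F}}\widehat{\mathbf{C}},\widehat{\mathbf{M}},\widehat{\mathbf{N}}$ are defined in the same way from $(\widehat{\mathbf{A}},\widehat{\mathbf{B}},\widehat{\mathbf{C}})$. Norms: for $\mathbf{H}$ analytic on the open right half-plane, $\|\mathbf{H}\|_{\mathcal{H}_2}=\left(\sup_{\sigma>0}\int_{-\infty}^{\infty}\|\mathbf{H}(\sigma+\imath\omega)\|_F^2\,d\omega\right)^{1/2}$; for $\mathbf{H}$ meromorphic on $\mathbb{C}$, $\|\mathbf{H}\|_{\mathcal{L}_2}=\left(\int_{-\infty}^{\infty}\|\mathbf{H}(\imath\omega)\|_F^2\,d\omega\right)^{1/2}$ and $\|\mathbf{H}\|_{\mathcal{L}_\infty}=\sup_{\omega\in\mathbb{R}}\sigma_{\max}(\mathbf{H}(\imath\omega))$, with $\sigma_{\max}$ the largest singular value and $\|\cdot\|_F$ the Frobenius norm. The $\mathcal{H}_2$-gap is $$\|\mathbf{G}-\widehat{\mathbf{G}}\|_{\mathcal{H}_2\text{-gap}}:=\left\|[\mathbf{M},\mathbf{N}]-[\widehat{\mathbf{M}},\widehat{\mathbf{N}}]\right\|_{\mathcal{H}_2}.$$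 *)

theory Defs
  imports "HOL-Analysis.Analysis"
begin

text \<open>A matrix with \<open>p\<close> rows and \<open>n\<close> columns has type \<open>_ ^ 'n ^ 'p\<close>. The inherited \<open>norm\<close> of such
  a matrix is its Frobenius norm:\<close>

lemma norm_eq_frobenius:
  fixes X :: "complex ^ 'n ^ 'm"
  shows "norm X = sqrt (\<Sum>i\<in>UNIV. \<Sum>j\<in>UNIV. (cmod (X $ i $ j))\<^sup>2)"
  by (simp add: norm_vec_def L2_set_def sum_nonneg)

definition cmat :: "real ^ 'n ^ 'm \<Rightarrow> complex ^ 'n ^ 'm" where
  "cmat X = (\<chi> i j. complex_of_real (X $ i $ j))"

definition adjoint_mat :: "complex ^ 'n ^ 'm \<Rightarrow> complex ^ 'm ^ 'n" where
  "adjoint_mat X = (\<chi> i j. cnj (X $ j $ i))"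

definition hconcat :: "'a ^ 'n::finite ^ 'p \<Rightarrow> 'a ^ 'm::finite ^ 'p \<Rightarrow> 'a ^ ('n + 'm) ^ 'p" where
  "hconcat X Y = (\<chi> i j. case j of Inl k \<Rightarrow> X $ i $ k | Inr l \<Rightarrow> Y $ i $ l)"

definition mat_spectrum :: "complex ^ 'n ^ 'n \<Rightarrow> complex set" where
  "mat_spectrum X = {l. \<exists>v. v \<noteq> 0 \<and> X *v v = l *s v}"

text \<open>The set below may contain a zero that is not counted as a singular value when there are more
  columns than rows; this does not affect the maximum.\<close>

definition sigma_max :: "complex ^ 'n ^ 'm \<Rightarrow> real" where
  "sigma_max X =
     Max {s. 0 \<le> s \<and> complex_of_real (s\<^sup>2) \<in> mat_spectrum (adjoint_mat X ** X)}"

definition asymp_stable :: "real ^ 'n ^ 'n \<Rightarrow> bool" where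
  "asymp_stable A \<longleftrightarrow> (\<forall>l \<in> mat_spectrum (cmat A). Re l < 0)"

definition stabilizable :: "real ^ 'n ^ 'n \<Rightarrow> real ^ 'm ^ 'n \<Rightarrow> bool" where
  "stabilizable A B \<longleftrightarrow> (\<exists>K :: real ^ 'n ^ 'm. asymp_stable (A - B ** K))"

definition detectable :: "real ^ 'n ^ 'n \<Rightarrow> real ^ 'n ^ 'p \<Rightarrow> bool" where
  "detectable A C \<longleftrightarrow> (\<exists>L :: real ^ 'p ^ 'n. asymp_stable (A - L ** C))"

definition sym_psd :: "real ^ 'n ^ 'n \<Rightarrow> bool" where
  "sym_psd P \<longleftrightarrow> transpose P = P \<and> (\<forall>x. 0 \<le> x \<bullet> (P *v x))"

text \<open>If \<open>(A, B)\<close> is stabilizable and \<open>(A, C)\<close> is detectable, there is exactly one such \<open>P\<close>.\<close>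

definition riccati_solution ::
  "real ^ 'n ^ 'n \<Rightarrow> real ^ 'm ^ 'n \<Rightarrow> real ^ 'n ^ 'p \<Rightarrow> real ^ 'n ^ 'n \<Rightarrow> bool" where
  "riccati_solution A B C P \<longleftrightarrow> sym_psd P \<and>
     A ** P + P ** transpose A - P ** transpose C ** C ** P + B ** transpose B = 0"

definition resolvent :: "real ^ 'n ^ 'n \<Rightarrow> complex \<Rightarrow> complex ^ 'n ^ 'n" where
  "resolvent A s = matrix_inv (mat s - cmat A)"

definition transfer_fun ::
  "real ^ 'n ^ 'n \<Rightarrow> real ^ 'm ^ 'n \<Rightarrow> real ^ 'n ^ 'p \<Rightarrow> complex \<Rightarrow> complex ^ 'm ^ 'p" where
  "transfer_fun A B C s = cmat C ** resolvent A s ** cmat B"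

definition coprime_M ::
  "real ^ 'n ^ 'n \<Rightarrow> real ^ 'n ^ 'p \<Rightarrow> real ^ 'p ^ 'n \<Rightarrow> complex \<Rightarrow> complex ^ 'p ^ 'p" where
  "coprime_M A C F s = mat 1 - cmat C ** resolvent (A - F ** C) s ** cmat F"

definition coprime_N ::
  "real ^ 'n ^ 'n \<Rightarrow> real ^ 'm ^ 'n \<Rightarrow> real ^ 'n ^ 'p \<Rightarrow> real ^ 'p ^ 'n \<Rightarrow> complex \<Rightarrow> complex ^ 'm ^ 'p"
  where "coprime_N A B C F s = cmat C ** resolvent (A - F ** C) s ** cmat B"

definition coprime_factorization ::
  "real ^ 'n ^ 'n \<Rightarrow> real ^ 'm::finite ^ 'n \<Rightarrow> real ^ 'n ^ 'p::finite \<Rightarrow> real ^ 'p ^ 'n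
   \<Rightarrow> complex \<Rightarrow> complex ^ ('p + 'm) ^ 'p" where
  "coprime_factorization A B C F s = hconcat (coprime_M A C F s) (coprime_N A B C F s)"

text \<open>The norms are extended nonnegative reals, so that a divergent integral gives \<open>\<infinity>\<close> and not \<open>0\<close>.
  They are meant for functions that are analytic on the open right half-plane (\<open>h2_norm\<close>) or
  meromorphic without poles on the imaginary axis (\<open>l2_norm\<close>, \<open>linf_norm\<close>): a total function
  has an arbitrary value at a pole.\<close>

definition ennreal_sqrt :: "ennreal \<Rightarrow> ennreal" where
  "ennreal_sqrt x = (if x = \<infinity> then \<infinity> else ennreal (sqrt (enn2real x)))"

definition h2_norm :: "(complex \<Rightarrow> complex ^ 'n ^ 'm) \<Rightarrow> ennreal" where
  "h2_norm H = ennreal_sqrt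
     (SUP \<sigma> \<in> {0 :: real <..}. \<integral>\<^sup>+ \<omega>. ennreal ((norm (H (Complex \<sigma> \<omega>)))\<^sup>2) \<partial>lborel)"

definition l2_norm :: "(complex \<Rightarrow> complex ^ 'n ^ 'm) \<Rightarrow> ennreal" where
  "l2_norm H = ennreal_sqrt (\<integral>\<^sup>+ \<omega>. ennreal ((norm (H (\<i> * complex_of_real \<omega>)))\<^sup>2) \<partial>lborel)"

definition linf_norm :: "(complex \<Rightarrow> complex ^ 'n ^ 'm) \<Rightarrow> ennreal" where
  "linf_norm H = (SUP \<omega> :: real. ennreal (sigma_max (H (\<i> * complex_of_real \<omega>))))"

text \<open>The gap between two systems, given with the gains \<open>F\<close> and \<open>F'\<close> obtained from their Riccati
  solutions.\<close>

definition h2_gap ::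
  "real ^ 'n ^ 'n \<Rightarrow> real ^ 'm::finite ^ 'n \<Rightarrow> real ^ 'n ^ 'p::finite \<Rightarrow> real ^ 'p ^ 'n
   \<Rightarrow> real ^ 'r ^ 'r \<Rightarrow> real ^ 'm ^ 'r \<Rightarrow> real ^ 'r ^ 'p \<Rightarrow> real ^ 'p ^ 'r \<Rightarrow> ennreal" where
  "h2_gap A B C F A' B' C' F' =
     h2_norm (\<lambda>s. coprime_factorization A B C F s - coprime_factorization A' B' C' F' s)"

end

theory Submission
  imports Defs
begin

text \<open>On the imaginary axis \<open>M G = N\<close> and \<open>M' G' = N'\<close> give
  \<open>G - G' = M'\<^sup>-\<^sup>1 ((N - N') - (M - M') G)\<close>. The Frobenius norm of a product is at most the largest
  singular value of one factor times the Frobenius norm of the other, so Minkowski's inequality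
  bounds the \<open>L\<^sub>2\<close> norm by the \<open>L\<^sub>2\<close> norms of \<open>M - M'\<close> and \<open>N - N'\<close>. As \<open>A - F C\<close> and \<open>A' - F' C'\<close>
  are stable, these functions are continuous up to the axis, and Fatou's lemma bounds their \<open>L\<^sub>2\<close>
  norms by their \<open>H\<^sub>2\<close> norms.\<close>

section \<open>Adjoints and the real inner product on complex vectors\<close>

lemma inner_adjoint_mat:
  fixes X :: "complex ^ 'n ^ 'm"
  shows "(X *v u) \<bullet> v = u \<bullet> (adjoint_mat X *v v)"
proof -
  have "(X *v u) \<bullet> v = (\<Sum>i\<in>UNIV. \<Sum>j\<in>UNIV. (X $ i $ j * u $ j) \<bullet> v $ i)"
    by (simp add: inner_vec_def matrix_vector_mult_def inner_sum_left)
  also have "\<dots> = (\<Sum>i\<in>UNIV. \<Sum>j\<in>UNIV. u $ j \<bullet> (cnj (X $ i $ j) * v $ i))"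
    by (intro sum.cong refl) (simp add: inner_complex_def algebra_simps)
  also have "\<dots> = (\<Sum>j\<in>UNIV. \<Sum>i\<in>UNIV. u $ j \<bullet> (cnj (X $ i $ j) * v $ i))"
    by (rule sum.swap)
  also have "\<dots> = u \<bullet> (adjoint_mat X *v v)"
    by (simp add: inner_vec_def matrix_vector_mult_def inner_sum_right adjoint_mat_def)
  finally show ?thesis .
qed

lemma adjoint_mat_adjoint_mat [simp]: "adjoint_mat (adjoint_mat X) = X"
  by (simp add: adjoint_mat_def vec_eq_iff)

lemma adjoint_mat_mult: "adjoint_mat (X ** Y) = adjoint_mat Y ** adjoint_mat X"
  by (simp add: adjoint_mat_def vec_eq_iff matrix_matrix_mult_def mult.commute)

lemma norm_adjoint_mat: "norm (adjoint_mat X) = norm X"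
  unfolding norm_eq_frobenius
  by (subst sum.swap) (simp add: adjoint_mat_def)

lemma of_real_smult: "complex_of_real c *s v = c *\<^sub>R v"
  by (simp add: vec_eq_iff complex_eq_iff)

text \<open>On \<open>complex ^ 'n\<close> the inner product is the real part of the Hermitian one,
  hence only real-linear. A complex eigenvalue \<open>l\<close> therefore leaves two terms, one
  weighted by \<open>Re l\<close> and one by \<open>Im l\<close>.\<close>

lemma smult_inner:
  fixes v w :: "complex ^ 'n"
  shows "(l *s v) \<bullet> w = Re l * (v \<bullet> w) + Im l * ((\<i> *s v) \<bullet> w)"
  by (simp add: inner_vec_def inner_complex_def sum_distrib_left sum.distrib[symmetric] algebra_simps)

lemma i_smult_inner:
  fixes v w :: "complex ^ 'n"
  shows "(\<i> *s v) \<bullet> w = - (v \<bullet> (\<i> *s w))"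
  by (simp add: inner_vec_def inner_complex_def sum_negf[symmetric])

lemma inner_adjoint_mat_self:
  fixes X :: "complex ^ 'n ^ 'm"
  shows "(adjoint_mat X ** X *v u) \<bullet> v = (X *v u) \<bullet> (X *v v)"
  using inner_adjoint_mat[of "adjoint_mat X" "X *v u" v]
  by (simp add: matrix_vector_mul_assoc)

section \<open>The largest singular value as an operator norm\<close>

lemma finite_sigma_max_set:
  fixes X :: "complex ^ 'n ^ 'm"
  shows "finite {s. 0 \<le> s \<and> complex_of_real (s\<^sup>2) \<in> mat_spectrum (adjoint_mat X ** X)}"
    (is "finite ?S")
proof -
  let ?H = "adjoint_mat X ** X"
  have "\<exists>v. v \<noteq> 0 \<and> ?H *v v = s\<^sup>2 *\<^sub>R v" if s: "s \<in> ?S" for s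
  proof -
    obtain v where "v \<noteq> 0" "?H *v v = complex_of_real (s\<^sup>2) *s v"
      using s by (auto simp: mat_spectrum_def simp del: of_real_power)
    then show ?thesis
      unfolding of_real_smult by (intro exI[of _ v]) simp
  qed
  then have "\<forall>s\<in>?S. \<exists>v. v \<noteq> 0 \<and> ?H *v v = s\<^sup>2 *\<^sub>R v" ..
  then obtain e where e: "\<forall>s\<in>?S. e s \<noteq> 0 \<and> ?H *v e s = s\<^sup>2 *\<^sub>R e s"
    unfolding bchoice_iff by blast
  \<comment> \<open>The Gram matrix is self-adjoint also for the real inner product, and distinct
    nonnegative numbers have distinct squares.\<close>
  have orth: "e s \<bullet> e t = 0" if "s \<in> ?S" "t \<in> ?S" "s \<noteq> t" for s t
  proof -
    have "s\<^sup>2 * (e s \<bullet> e t) = (?H *v e s) \<bullet> e t"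
      using bspec[OF e that(1)] by simp
    also have "\<dots> = (?H *v e t) \<bullet> e s"
      unfolding inner_adjoint_mat_self by (rule inner_commute)
    also have "\<dots> = t\<^sup>2 * (e s \<bullet> e t)"
      using bspec[OF e that(2)] by (simp add: inner_commute)
    finally show ?thesis
      using that by (auto simp: power2_eq_iff_nonneg)
  qed
  have inj: "inj_on e ?S"
  proof (rule inj_onI, rule ccontr)
    fix s t assume "s \<in> ?S" "t \<in> ?S" "e s = e t" "s \<noteq> t"
    then show False
      using orth[of s t] bspec[OF e, of s] by simp
  qed
  have "pairwise orthogonal (e ` ?S)"
    unfolding pairwise_def orthogonal_def using orth by blast
  \<comment> \<open>Orthogonal nonzero vectors are linearly independent over the reals, and the real
    dimension of \<open>complex ^ 'n\<close> is finite.\<close>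
  then have "independent (e ` ?S)"
    using e by (intro pairwise_orthogonal_independent) auto
  then have "finite (e ` ?S)"
    by (rule independent_imp_finite)
  then show ?thesis
    using inj by (rule finite_imageD)
qed

text \<open>Cauchy-Schwarz bounds the squared norm of \<open>adjoint_mat X *v w\<close> by the norm
  of its image under \<open>X\<close> times \<open>norm w\<close>; then one factor cancels.\<close>

lemma norm_adjoint_mult_le:
  fixes X :: "complex ^ 'n ^ 'm"
  assumes "\<And>u. norm (X *v u) \<le> s * norm u" and "0 \<le> s"
  shows "norm (adjoint_mat X *v w) \<le> s * norm w"
proof (cases "adjoint_mat X *v w = 0")
  case False
  let ?y = "adjoint_mat X *v w"
  have "norm ?y * norm ?y = (X *v ?y) \<bullet> w"
    by (simp add: inner_adjoint_mat dot_square_norm power2_eq_square)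
  also have "\<dots> \<le> norm (X *v ?y) * norm w"
    by (rule norm_cauchy_schwarz)
  also have "\<dots> \<le> norm ?y * (s * norm w)"
    using mult_right_mono[OF assms(1)[of ?y], of "norm w"] by (simp add: mult_ac)
  finally show ?thesis
    using False by simp
qed (simp add: assms)

text \<open>A unit vector maximising the norm of \<open>X *v v\<close> is an eigenvector of the Gram matrix of \<open>X\<close>, and
  the set that defines \<open>sigma_max\<close> is finite because eigenvectors to distinct eigenvalues are
  orthogonal.\<close>

lemma
  fixes X :: "complex ^ 'n ^ 'm"
  shows norm_matrix_vector_le_sigma_max: "norm (X *v v) \<le> sigma_max X * norm v"
    and sigma_max_nonneg: "0 \<le> sigma_max X"
proof -
  let ?H = "adjoint_mat X ** X"
  have cont: "continuous_on (sphere 0 1) (\<lambda>v. norm (X *v v))"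
    by (intro continuous_on_norm linear_continuous_on linear_conv_bounded_linear[THEN iffD1]) simp
  have "sphere (0 :: complex ^ 'n) 1 \<noteq> {}"
    by (simp add: sphere_eq_empty)
  then obtain u where u: "norm u = 1"
    and max: "\<And>v. norm v = 1 \<Longrightarrow> norm (X *v v) \<le> norm (X *v u)"
    using continuous_attains_sup[OF compact_sphere _ cont] by (auto simp: dist_norm)
  define s where "s = norm (X *v u)"
  have le: "norm (X *v v) \<le> s * norm v" for v
  proof (cases "v = 0")
    case False
    interpret linear "(*v) X" by simp
    have "norm (X *v (v /\<^sub>R norm v)) \<le> s"
      using max[of "v /\<^sub>R norm v"] False by (simp add: s_def)
    then show ?thesis
      using False by (simp add: scaleR divide_simps mult.commute)
  qed simp
  have s0: "0 \<le> s"
    by (simp add: s_def)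
  have "norm (?H *v u) \<le> s\<^sup>2"
    using norm_adjoint_mult_le[OF le s0, of "X *v u"]
    by (simp add: matrix_vector_mul_assoc s_def power2_eq_square)
  then have 1: "(norm (?H *v u))\<^sup>2 \<le> s ^ 4"
    using power_mono[of "norm (?H *v u)" "s\<^sup>2" 2] by simp
  have 2: "(?H *v u) \<bullet> u = s\<^sup>2"
    by (simp add: inner_adjoint_mat_self s_def dot_square_norm)
  \<comment> \<open>This is the equality case of Cauchy-Schwarz: as \<open>norm u = 1\<close> and
    \<open>(?H *v u) \<bullet> u\<close> attains the upper bound for \<open>norm (?H *v u)\<close>,
    the two vectors are parallel.\<close>
  have "(norm (?H *v u - s\<^sup>2 *\<^sub>R u))\<^sup>2
      = (norm (?H *v u))\<^sup>2 - 2 * s\<^sup>2 * ((?H *v u) \<bullet> u) + s ^ 4 * (norm u)\<^sup>2"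
    unfolding power2_norm_eq_inner
    by (simp add: inner_diff inner_commute[of u "?H *v u"] power4_eq_xxxx)
      (simp add: power2_eq_square algebra_simps)
  also have "\<dots> \<le> 0"
    using 1 unfolding 2 by (simp add: u power2_eq_square power4_eq_xxxx)
  finally have "?H *v u = complex_of_real (s\<^sup>2) *s u"
    unfolding of_real_smult by simp
  moreover have "u \<noteq> 0" using u by auto
  ultimately have "s \<in> {s. 0 \<le> s \<and> complex_of_real (s\<^sup>2) \<in> mat_spectrum ?H}"
    by (auto simp: mat_spectrum_def s_def)
  then have s: "s \<le> sigma_max X"
    unfolding sigma_max_def by (rule Max_ge[OF finite_sigma_max_set])
  show "0 \<le> sigma_max X"
    using s s_def order_trans[OF norm_ge_zero] by blast
  show "norm (X *v v) \<le> sigma_max X * norm v"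
    using le[of v] mult_right_mono[OF s, of "norm v"] by simp
qed

lemma column_matrix_mult: "column j (X ** Y) = X *v column j Y"
  by (simp add: column_def matrix_matrix_mult_def matrix_vector_mult_def vec_eq_iff)

text \<open>The squared Frobenius norm is the sum of the squared column norms, and \<open>X\<close>
  acts on \<open>Y\<close> column by column.\<close>

lemma norm_matrix_mult_le_of_bound:
  fixes X :: "complex ^ 'n ^ 'm" and Y :: "complex ^ 'k ^ 'n"
  assumes "\<And>u. norm (X *v u) \<le> s * norm u" and "0 \<le> s"
  shows "norm (X ** Y) \<le> s * norm Y"
proof -
  have sq: "(norm Z)\<^sup>2 = (\<Sum>j\<in>UNIV. (norm (column j Z))\<^sup>2)" for Z :: "complex ^ 'k ^ 'l"
  proof -
    have "(norm Z)\<^sup>2 = (\<Sum>i\<in>UNIV. \<Sum>j\<in>UNIV. (cmod (Z $ i $ j))\<^sup>2)"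
      by (simp add: norm_eq_frobenius sum_nonneg)
    also have "\<dots> = (\<Sum>j\<in>UNIV. (norm (column j Z))\<^sup>2)"
      by (subst sum.swap) (simp add: norm_vec_def L2_set_def sum_nonneg column_def)
    finally show ?thesis .
  qed
  have "(norm (X ** Y))\<^sup>2 \<le> (\<Sum>j\<in>UNIV. s\<^sup>2 * (norm (column j Y))\<^sup>2)"
    unfolding sq column_matrix_mult using assms by (intro sum_mono) (metis norm_ge_zero power_mono power_mult_distrib)
  also have "\<dots> = (s * norm Y)\<^sup>2"
    by (simp add: sq[of Y] sum_distrib_left power_mult_distrib)
  finally show ?thesis
    by (rule power2_le_imp_le) (simp add: assms(2))
qed

lemma norm_matrix_mult_le_sigma_max_left: "norm (X ** Y) \<le> sigma_max X * norm Y"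
  by (rule norm_matrix_mult_le_of_bound[OF norm_matrix_vector_le_sigma_max sigma_max_nonneg])

text \<open>Taking adjoints reverses the product and preserves the Frobenius norm, so the bound
  follows from an operator bound for \<open>adjoint_mat Y\<close>.\<close>

lemma norm_matrix_mult_le_sigma_max_right: "norm (X ** Y) \<le> norm X * sigma_max Y"
  using norm_matrix_mult_le_of_bound[OF
      norm_adjoint_mult_le[OF norm_matrix_vector_le_sigma_max sigma_max_nonneg] sigma_max_nonneg,
      of Y "adjoint_mat X"]
  by (simp add: adjoint_mat_mult[symmetric] norm_adjoint_mat mult.commute)

section \<open>Complexified real matrices and their spectra\<close>

lemma adjoint_mat_cmat: "adjoint_mat (cmat X) = cmat (transpose X)"
  by (simp add: adjoint_mat_def cmat_def transpose_def vec_eq_iff)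

lemma cmat_add: "cmat (X + Y) = cmat X + cmat Y"
  and cmat_diff: "cmat (X - Y) = cmat X - cmat Y"
  and cmat_mult: "cmat (X ** Z) = cmat X ** cmat Z"
  and cmat_0: "cmat 0 = 0"
  and cmat_transpose: "cmat (transpose X) = transpose (cmat X)"
  by (simp_all add: cmat_def vec_eq_iff matrix_matrix_mult_def transpose_def)

lemma transpose_diff: "transpose (X - Y) = transpose X - transpose Y"
  by (simp add: transpose_def vec_eq_iff)

lemma matrix_diff_ldistrib: "X ** (Y - Z) = X ** Y - X ** Z"
  for X :: "'a::ring_1 ^ 'n ^ 'm"
  by (simp add: vec_eq_iff matrix_matrix_mult_def right_diff_distrib sum_subtractf)

lemma matrix_diff_rdistrib: "(Y - Z) ** X = Y ** X - Z ** X"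
  for X :: "'a::ring_1 ^ 'n ^ 'm"
  by (simp add: vec_eq_iff matrix_matrix_mult_def left_diff_distrib sum_subtractf)

lemma mat_vector_mult: "mat (c :: 'a::comm_semiring_1) *v v = c *s v"
  by (simp add: vec_eq_iff matrix_vector_mult_def mat_def if_distrib[of "\<lambda>x. x * _"] cong: if_cong)

lemma invertible_iff_ker:
  fixes X :: "complex ^ 'n ^ 'n"
  shows "invertible X \<longleftrightarrow> (\<forall>v. X *v v = 0 \<longrightarrow> v = 0)"
  by (simp add: invertible_left_inverse matrix_left_invertible_ker)

lemma in_mat_spectrum_iff: "l \<in> mat_spectrum X \<longleftrightarrow> \<not> invertible (mat l - X)"
  by (auto simp: mat_spectrum_def invertible_iff_ker matrix_vector_mult_diff_rdistrib mat_vector_mult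
      eq_commute[of "l *s _"])

lemma mat_spectrum_transpose: "mat_spectrum (transpose X) = mat_spectrum X"
proof -
  have "mat l - transpose X = transpose (mat l - X)" for l
    by (simp add: vec_eq_iff transpose_def mat_def)
  then show ?thesis
    by (auto simp: in_mat_spectrum_iff invertible_det_nz)
qed

section \<open>Closed-loop stability from the Riccati equation\<close>

lemma inner_cmat:
  fixes X :: "real ^ 'n ^ 'm"
  shows "(cmat X *v u) \<bullet> v = u \<bullet> (cmat (transpose X) *v v)"
  by (simp only: inner_adjoint_mat adjoint_mat_cmat)

text \<open>As \<open>P\<close> is real, the form splits into the real forms at the real and
  imaginary parts of \<open>v\<close>.\<close>

lemma inner_cmat_sym_psd_nonneg:
  assumes "sym_psd P"
  shows "0 \<le> v \<bullet> (cmat P *v v)"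
proof -
  define x y where "x = (\<chi> i. Re (v $ i))" and "y = (\<chi> i. Im (v $ i))"
  have "v \<bullet> (cmat P *v v) = x \<bullet> (P *v x) + y \<bullet> (P *v y)"
    by (simp add: inner_vec_def inner_complex_def x_def y_def cmat_def matrix_vector_mult_def
        sum.distrib)
  then show ?thesis
    using assms by (simp add: sym_psd_def)
qed

text \<open>The left side is, up to sign, the imaginary part of the Hermitian form of
  \<open>P\<close> at \<open>v\<close>. Symmetry of \<open>P\<close> and skewness of multiplication
  by \<open>\<i>\<close> make it its own negative. This removes the \<open>Im l\<close> terms that
  \<open>smult_inner\<close> produces.\<close>

lemma inner_i_smult_cmat_sym:
  assumes "transpose P = P"
  shows "(\<i> *s v) \<bullet> (cmat P *v v) = 0"
proof -
  have "(\<i> *s v) \<bullet> (cmat P *v v) = v \<bullet> (\<i> *s (cmat P *v v))"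
    using inner_cmat[of P v "\<i> *s v"] assms by (simp add: vector_scalar_commute inner_commute)
  then show ?thesis
    using i_smult_inner[of v "cmat P *v v"] by simp
qed

text \<open>An eigenvector of \<open>(A - F C)\<^sup>T\<close> in the closed right half-plane is annihilated by \<open>C P\<close> and
  \<open>B\<^sup>T\<close>, as the Riccati equation expresses a sum of nonnegative terms. Hence it is an eigenvector of
  \<open>(A - B K)\<^sup>T\<close> for every \<open>K\<close>, which stabilizability forbids.\<close>

lemma riccati_asymp_stable:
  fixes A :: "real ^ 'n ^ 'n" and B :: "real ^ 'm ^ 'n" and C :: "real ^ 'n ^ 'p"
  assumes stab: "stabilizable A B" and ric: "riccati_solution A B C P"
    and F: "F = P ** transpose C"
  shows "asymp_stable (A - F ** C)"
  unfolding asymp_stable_def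
proof (rule ballI, rule ccontr)
  fix l assume "l \<in> mat_spectrum (cmat (A - F ** C))" and l: "\<not> Re l < 0"
  then have "l \<in> mat_spectrum (cmat (transpose (A - F ** C)))"
    by (simp add: cmat_transpose mat_spectrum_transpose)
  then obtain v where v: "v \<noteq> 0" and ev: "cmat (transpose (A - F ** C)) *v v = l *s v"
    by (auto simp: mat_spectrum_def)
  define q where "q = v \<bullet> (cmat P *v v)"
  have psd: "sym_psd P" and sym: "transpose P = P"
    using ric by (auto simp: riccati_solution_def sym_psd_def)
  have q: "0 \<le> q"
    unfolding q_def using psd by (rule inner_cmat_sym_psd_nonneg)
  have T: "transpose (A - F ** C) = transpose A - transpose C ** C ** P"
    by (simp add: F transpose_diff matrix_transpose_mul sym matrix_mul_assoc)
  \<comment> \<open>The Riccati equation becomes a Lyapunov equation for \<open>A - F ** C\<close>: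
    each closed-loop term absorbs one copy of the quadratic term, which turns its sign to plus. Its
    quadratic form at \<open>v\<close> is then a vanishing sum of four nonnegative terms.\<close>
  have "(A - F ** C) ** P + P ** transpose (A - F ** C) + transpose (C ** P) ** (C ** P)
      + B ** transpose B = 0"
    using ric unfolding T
    by (simp add: riccati_solution_def F matrix_diff_ldistrib matrix_diff_rdistrib
        matrix_transpose_mul sym matrix_mul_assoc)
  then have "cmat ((A - F ** C) ** P + P ** transpose (A - F ** C) + transpose (C ** P) ** (C ** P)
      + B ** transpose B) *v v = 0"
    by (simp add: cmat_0)
  then have "v \<bullet> (cmat (A - F ** C) *v (cmat P *v v))
      + v \<bullet> (cmat P *v (cmat (transpose (A - F ** C)) *v v))
      + v \<bullet> (cmat (transpose (C ** P)) *v (cmat (C ** P) *v v))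
      + v \<bullet> (cmat B *v (cmat (transpose B) *v v)) = 0"
    by (simp add: cmat_add cmat_mult matrix_vector_mult_add_rdistrib matrix_vector_mul_assoc
        flip: inner_add_right)
  moreover have "v \<bullet> (cmat (A - F ** C) *v (cmat P *v v)) = Re l * q"
    using inner_cmat[of "transpose (A - F ** C)" v "cmat P *v v"]
    by (simp add: ev smult_inner[of l] inner_i_smult_cmat_sym[OF sym] q_def)
  moreover have "v \<bullet> (cmat P *v (cmat (transpose (A - F ** C)) *v v)) = Re l * q"
    using inner_cmat[of P v "l *s v"]
    by (simp add: ev sym inner_commute[of _ "l *s v"] smult_inner[of l] inner_i_smult_cmat_sym[OF sym] q_def)
  moreover have "v \<bullet> (cmat (transpose (C ** P)) *v (cmat (C ** P) *v v)) = (norm (cmat (C ** P) *v v))\<^sup>2"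
    using inner_cmat[of "C ** P" v "cmat (C ** P) *v v"] by (simp add: dot_square_norm)
  moreover have "v \<bullet> (cmat B *v (cmat (transpose B) *v v)) = (norm (cmat (transpose B) *v v))\<^sup>2"
    using inner_cmat[of "transpose B" v "cmat (transpose B) *v v"] by (simp add: dot_square_norm)
  moreover have "0 \<le> Re l * q"
    using l q by simp
  ultimately have "(norm (cmat (C ** P) *v v))\<^sup>2 = 0" and "(norm (cmat (transpose B) *v v))\<^sup>2 = 0"
    using zero_le_power2[of "norm (cmat (C ** P) *v v)"]
      zero_le_power2[of "norm (cmat (transpose B) *v v)"] by linarith+
  then have CP: "cmat (C ** P) *v v = 0" and BT: "cmat (transpose B) *v v = 0"
    by simp_all
  obtain K where K: "asymp_stable (A - B ** K)"
    using stab by (auto simp: stabilizable_def)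
  \<comment> \<open>The two closed loops differ only by terms that end in \<open>C ** P\<close> or
    \<open>transpose B\<close>, both of which annihilate \<open>v\<close>.\<close>
  have *: "transpose (A - B ** K) = transpose (A - F ** C) + transpose C ** (C ** P) - transpose K ** transpose B"
    unfolding T by (simp add: transpose_diff matrix_transpose_mul matrix_mul_assoc)
  have "cmat (transpose (A - B ** K)) *v v = l *s v"
    unfolding * cmat_add cmat_diff[of "_ + _"] matrix_vector_mult_add_rdistrib
      matrix_vector_mult_diff_rdistrib ev cmat_mult[of "transpose _"] matrix_vector_mul_assoc[symmetric] CP BT
    by simp
  then have "l \<in> mat_spectrum (cmat (A - B ** K))"
    using v mat_spectrum_transpose[of "cmat (A - B ** K)"]
    by (auto simp: mat_spectrum_def cmat_transpose)
  then show False
    using K l by (auto simp: asymp_stable_def)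
qed

section \<open>Algebra of the left-coprime factors\<close>

lemma matrix_inv_right_inverse: "invertible X \<Longrightarrow> X ** matrix_inv X = mat 1"
  and matrix_inv_left_inverse: "invertible X \<Longrightarrow> matrix_inv X ** X = mat 1"
  unfolding matrix_inv_def invertible_def by (metis (mono_tags, lifting) someI_ex)+

text \<open>Multiplying the resolvent identity by \<open>cmat C\<close> shows that
  \<open>coprime_M\<close> maps \<open>cmat C ** ?R ** X\<close> to \<open>cmat C ** ?S ** X\<close>
  for every \<open>X\<close>. Taking \<open>X = cmat B\<close> gives \<open>coprime_N\<close>;
  taking \<open>X = cmat F\<close> shows that \<open>mat 1 + cmat C ** ?R ** cmat F\<close> is the
  inverse of \<open>coprime_M\<close>.\<close>

lemma
  fixes A :: "real ^ 'n ^ 'n" and B :: "real ^ 'm ^ 'n" and C :: "real ^ 'n ^ 'p"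
  assumes "s \<notin> mat_spectrum (cmat A)" and "s \<notin> mat_spectrum (cmat (A - F ** C))"
  shows coprime_M_mult_transfer_fun: "coprime_M A C F s ** transfer_fun A B C s = coprime_N A B C F s"
    and invertible_coprime_M: "invertible (coprime_M A C F s)"
proof -
  let ?R = "resolvent A s" and ?S = "resolvent (A - F ** C) s"
  have R: "(mat s - cmat A) ** ?R = mat 1"
    using assms(1) by (simp add: in_mat_spectrum_iff resolvent_def matrix_inv_right_inverse)
  have S: "?S ** (mat s - cmat (A - F ** C)) = mat 1"
    using assms(2) by (simp add: in_mat_spectrum_iff resolvent_def matrix_inv_left_inverse)
  \<comment> \<open>Resolvent identity: an identity matrix is inserted next to each resolvent, and
    the two shifted matrices differ by \<open>cmat (F ** C)\<close>.\<close>
  have "?R - ?S = ?S ** ((mat s - cmat (A - F ** C)) ** ?R) - ?S ** ((mat s - cmat A) ** ?R)"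
    unfolding R by (simp add: matrix_mul_assoc S)
  also have "\<dots> = ?S ** (cmat (F ** C) ** ?R)"
    by (simp add: matrix_diff_ldistrib[symmetric] matrix_diff_rdistrib[symmetric] cmat_diff)
  finally have SR: "?S ** cmat F ** cmat C ** ?R = ?R - ?S"
    by (simp add: cmat_mult matrix_mul_assoc)
  have SRX: "cmat C ** ?S ** cmat F ** (cmat C ** ?R ** X)
      = cmat C ** ?R ** X - cmat C ** ?S ** X" for X :: "complex ^ 'k ^ 'n"
  proof -
    have "cmat C ** ?S ** cmat F ** (cmat C ** ?R ** X)
        = cmat C ** (?S ** cmat F ** cmat C ** ?R) ** X"
      by (simp add: matrix_mul_assoc)
    then show ?thesis
      by (simp only: SR matrix_diff_ldistrib matrix_diff_rdistrib)
  qed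
  show "coprime_M A C F s ** transfer_fun A B C s = coprime_N A B C F s"
    by (simp add: coprime_M_def transfer_fun_def coprime_N_def matrix_diff_rdistrib SRX)
  have "coprime_M A C F s ** (mat 1 + cmat C ** ?R ** cmat F) = mat 1"
    by (simp add: coprime_M_def matrix_diff_rdistrib matrix_add_ldistrib SRX)
  then show "invertible (coprime_M A C F s)"
    by (auto simp: invertible_right_inverse)
qed

section \<open>Extended square roots and Minkowski's inequality\<close>

lemma ennreal_sqrt_power2: "(ennreal_sqrt x)\<^sup>2 = x"
  by (cases x) (simp_all add: ennreal_sqrt_def ennreal_power)

lemma ennreal_sqrt_le: "ennreal_sqrt x \<le> y" if "x \<le> y\<^sup>2"
proof (cases y)
  case (real r)
  then have "x \<le> ennreal (r\<^sup>2)"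
    using that by (simp add: ennreal_power)
  then show ?thesis
    using real by (cases x) (auto simp: ennreal_sqrt_def top_unique intro: real_le_lsqrt)
qed simp

lemma ennreal_sqrt_mono: "ennreal_sqrt x \<le> ennreal_sqrt y" if "x \<le> y"
  using that by (intro ennreal_sqrt_le) (simp add: ennreal_sqrt_power2)

text \<open>The square is expanded and Cauchy-Schwarz bounds the mixed term. Stating it with bounds
  \<open>a\<close> and \<open>b\<close> on the squares avoids roots of integrals and covers infinite
  norms.\<close>

lemma Minkowski_nn_integral_power2:
  assumes [measurable]: "f \<in> borel_measurable M" "g \<in> borel_measurable M"
    and a: "(\<integral>\<^sup>+x. (f x)\<^sup>2 \<partial>M) \<le> a\<^sup>2" and b: "(\<integral>\<^sup>+x. (g x)\<^sup>2 \<partial>M) \<le> b\<^sup>2"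
  shows "(\<integral>\<^sup>+x. (f x + g x)\<^sup>2 \<partial>M) \<le> (a + b)\<^sup>2"
proof -
  have "(\<integral>\<^sup>+x. f x * g x \<partial>M) \<le> ennreal_sqrt ((\<integral>\<^sup>+x. f x * g x \<partial>M)\<^sup>2)"
    by (cases "\<integral>\<^sup>+x. f x * g x \<partial>M") (simp_all add: ennreal_sqrt_def ennreal_power)
  also have "\<dots> \<le> a * b"
    using Cauchy_Schwarz_nn_integral[of f M g] mult_mono[OF a b]
    by (intro ennreal_sqrt_le) (simp add: power_mult_distrib)
  finally have ab: "(\<integral>\<^sup>+x. f x * g x \<partial>M) \<le> a * b" .
  have "(\<integral>\<^sup>+x. (f x + g x)\<^sup>2 \<partial>M) = (\<integral>\<^sup>+x. ((f x)\<^sup>2 + (g x)\<^sup>2) + 2 * (f x * g x) \<partial>M)"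
    by (simp add: power2_sum mult.assoc)
  also have "\<dots> = (\<integral>\<^sup>+x. (f x)\<^sup>2 \<partial>M) + (\<integral>\<^sup>+x. (g x)\<^sup>2 \<partial>M) + 2 * (\<integral>\<^sup>+x. f x * g x \<partial>M)"
    by (simp add: nn_integral_add nn_integral_cmult)
  also have "\<dots> \<le> a\<^sup>2 + b\<^sup>2 + 2 * (a * b)"
    by (intro add_mono a b ab mult_left_mono) simp
  finally show ?thesis
    by (simp add: power2_sum mult.assoc)
qed

section \<open>Continuity up to the imaginary axis\<close>

lemma continuous_on_matrix_mult [continuous_intros]:
  fixes X :: "'t::topological_space \<Rightarrow> complex ^ 'n ^ 'm" and Y :: "'t \<Rightarrow> complex ^ 'k ^ 'n"
  assumes "continuous_on S X" and "continuous_on S Y"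
  shows "continuous_on S (\<lambda>s. X s ** Y s)"
  unfolding matrix_matrix_mult_def
  by (intro continuous_on_vec_lambda continuous_intros continuous_on_component assms)

lemma continuous_on_det:
  fixes X :: "'t::topological_space \<Rightarrow> complex ^ 'n ^ 'n"
  assumes "\<And>i j. continuous_on S (\<lambda>s. X s $ i $ j)"
  shows "continuous_on S (\<lambda>s. det (X s))"
  unfolding det_def by (intro continuous_intros assms)

text \<open>By Cramer's rule each entry of the resolvent is a quotient of determinants, and the
  denominator vanishes only on the spectrum. Column \<open>j\<close> solves the linear system whose
  right-hand side is the \<open>j\<close>-th unit vector.\<close>

lemma continuous_on_resolvent:
  assumes "S \<inter> mat_spectrum (cmat A) = {}"
  shows "continuous_on S (resolvent A)"
proof -
  let ?X = "\<lambda>s. mat s - cmat A"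
  let ?f = "\<lambda>s. \<chi> i j. det (\<chi> a b. if b = i then column j (mat 1) $ a else ?X s $ a $ b) / det (?X s)"
  have inv: "invertible (?X s)" if "s \<in> S" for s
    using assms that in_mat_spectrum_iff by blast
  have eq: "resolvent A s = ?f s" if "s \<in> S" for s
  proof -
    have "?X s ** resolvent A s = mat 1"
      unfolding resolvent_def by (rule matrix_inv_right_inverse[OF inv[OF that]])
    then have "?X s *v column j (resolvent A s) = column j (mat 1)" for j
      by (simp flip: column_matrix_mult)
    then have "column j (resolvent A s) = (\<chi> i. ?f s $ i $ j)" for j
      using inv[OF that] by (simp add: cramer invertible_det_nz)
    then have "column j (resolvent A s) $ i = ?f s $ i $ j" for i j
      by simp
    then show ?thesis
      by (simp only: vec_eq_iff column_def vec_lambda_beta) blast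
  qed
  have X: "continuous_on S (\<lambda>s. ?X s $ i $ j)" for i j
    by (cases "i = j") (auto simp: mat_def intro!: continuous_intros)
  have "continuous_on S (\<lambda>s. (\<chi> a b. if b = i then column j (mat 1) $ a else ?X s $ a $ b) $ a $ b)" for i j a b
    using X[of a b] by (cases "b = i") auto
  then have "continuous_on S ?f"
    using inv by (intro continuous_on_vec_lambda continuous_on_divide continuous_on_det X)
      (auto simp: invertible_det_nz)
  then show ?thesis
    using eq by (simp cong: continuous_on_cong)
qed

lemma asymp_stable_continuous_on_resolvent:
  "continuous_on {s. 0 \<le> Re s} (resolvent A)" if "asymp_stable A"
  using that by (intro continuous_on_resolvent) (auto simp: asymp_stable_def disjoint_iff not_less[symmetric])

lemma
  assumes "asymp_stable (A - F ** C)"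
  shows continuous_on_coprime_M: "continuous_on {s. 0 \<le> Re s} (coprime_M A C F)"
    and continuous_on_coprime_N: "continuous_on {s. 0 \<le> Re s} (coprime_N A B C F)"
  unfolding coprime_M_def[abs_def] coprime_N_def[abs_def]
  by (intro continuous_intros asymp_stable_continuous_on_resolvent assms)+

section \<open>Boundary values and the norms\<close>

lemma h2_norm_power2:
  "(h2_norm H)\<^sup>2 = (SUP \<sigma>\<in>{0<..}. \<integral>\<^sup>+ \<omega>. ennreal ((norm (H (Complex \<sigma> \<omega>)))\<^sup>2) \<partial>lborel)"
  by (simp add: h2_norm_def ennreal_sqrt_power2)

lemma h2_norm_mono:
  "h2_norm H \<le> h2_norm K" if "\<And>s. norm (H s) \<le> norm (K s)"
  unfolding h2_norm_def
  by (intro ennreal_sqrt_mono SUP_mono' nn_integral_mono ennreal_leI power_mono that norm_ge_zero)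

lemma measurable_vertical_line:
  fixes H :: "complex \<Rightarrow> complex ^ 'n ^ 'm"
  assumes "continuous_on {s. 0 \<le> Re s} H" and "0 \<le> \<sigma>"
  shows "(\<lambda>\<omega>. norm (H (Complex \<sigma> \<omega>))) \<in> borel_measurable borel"
  by (intro borel_measurable_continuous_onI continuous_on_norm continuous_on_compose2[OF assms(1)])
    (auto simp: Complex_eq assms(2) intro!: continuous_intros)

text \<open>The supremum in \<open>h2_norm\<close> runs over lines strictly to the right of the
  axis, so the axis is reached only as a limit. Continuity gives pointwise convergence of the
  integrands, and Fatou's lemma the inequality.\<close>

lemma nn_integral_boundary_le_h2_norm:
  fixes H :: "complex \<Rightarrow> complex ^ 'n ^ 'm"
  assumes cont: "continuous_on {s. 0 \<le> Re s} H"
  shows "(\<integral>\<^sup>+ \<omega>. (ennreal (norm (H (Complex 0 \<omega>))))\<^sup>2 \<partial>lborel) \<le> (h2_norm H)\<^sup>2"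
proof -
  \<comment> \<open>Any positive null sequence serves; \<open>Suc\<close> keeps the first term
    positive.\<close>
  define \<sigma> :: "nat \<Rightarrow> real" where "\<sigma> k = inverse (of_nat (Suc k))" for k
  let ?u = "\<lambda>k \<omega>. (ennreal (norm (H (Complex (\<sigma> k) \<omega>))))\<^sup>2"
  have pos: "0 < \<sigma> k" for k
    by (simp add: \<sigma>_def)
  have [measurable]: "(\<lambda>\<omega>. norm (H (Complex (\<sigma> k) \<omega>))) \<in> borel_measurable borel" for k
    using pos[of k] by (intro measurable_vertical_line[OF cont]) simp
  have lim: "(\<lambda>k. ?u k \<omega>) \<longlonglongrightarrow> (ennreal (norm (H (Complex 0 \<omega>))))\<^sup>2" for \<omega>
  proof -
    have "(\<lambda>k. Complex (\<sigma> k) \<omega>) \<longlonglongrightarrow> Complex 0 \<omega>"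
      unfolding \<sigma>_def by (intro tendsto_Complex LIMSEQ_inverse_real_of_nat tendsto_const)
    then have "(\<lambda>k. H (Complex (\<sigma> k) \<omega>)) \<longlonglongrightarrow> H (Complex 0 \<omega>)"
      by (rule continuous_on_tendsto_compose[OF cont]) (auto simp: less_imp_le pos)
    then have "(\<lambda>k. ennreal ((norm (H (Complex (\<sigma> k) \<omega>)))\<^sup>2)) \<longlonglongrightarrow> ennreal ((norm (H (Complex 0 \<omega>)))\<^sup>2)"
      by (intro tendsto_intros)
    then show ?thesis
      by (simp add: ennreal_power)
  qed
  have "(\<integral>\<^sup>+ \<omega>. (ennreal (norm (H (Complex 0 \<omega>))))\<^sup>2 \<partial>lborel) = (\<integral>\<^sup>+ \<omega>. liminf (\<lambda>k. ?u k \<omega>) \<partial>lborel)"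
    using lim_imp_Liminf[OF _ lim] by simp
  also have "\<dots> \<le> liminf (\<lambda>k. \<integral>\<^sup>+ \<omega>. ?u k \<omega> \<partial>lborel)"
    by (rule nn_integral_liminf) simp
  also have "\<dots> \<le> liminf (\<lambda>k::nat. (h2_norm H)\<^sup>2)"
  proof (intro Liminf_mono always_eventually allI)
    show "(\<integral>\<^sup>+ \<omega>. ?u k \<omega> \<partial>lborel) \<le> (h2_norm H)\<^sup>2" for k
      unfolding h2_norm_power2 by (rule SUP_upper2[of "\<sigma> k"]) (simp_all add: pos ennreal_power)
  qed
  finally show ?thesis
    by (simp add: Liminf_const)
qed

lemma sigma_max_le_linf_norm: "ennreal (sigma_max (H (Complex 0 \<omega>))) \<le> linf_norm H"
  unfolding linf_norm_def by (rule SUP_upper2[of \<omega>]) (simp_all add: Complex_eq)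

lemma l2_norm_power2:
  "(l2_norm H)\<^sup>2 = (\<integral>\<^sup>+ \<omega>. (ennreal (norm (H (Complex 0 \<omega>))))\<^sup>2 \<partial>lborel)"
  by (simp add: l2_norm_def ennreal_sqrt_power2 Complex_eq ennreal_power)

lemma ennreal_norm_matrix_mult_le:
  shows "ennreal (norm (X ** Y)) \<le> ennreal (sigma_max X) * ennreal (norm Y)"
    and "ennreal (norm (X ** Y)) \<le> ennreal (sigma_max Y) * ennreal (norm X)"
  using norm_matrix_mult_le_sigma_max_left[of X Y] norm_matrix_mult_le_sigma_max_right[of X Y]
  by (simp_all add: sigma_max_nonneg ennreal_leI mult.commute flip: ennreal_mult)

section \<open>The main estimate and the gap\<close>

text \<open>Here \<open>M\<close> and \<open>N\<close> stand for the differences of the coprime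
  factors and \<open>L\<close> for the inverse of the second denominator. On the axis
  \<open>L\<close> and \<open>G\<close> are replaced by their suprema before integrating, so that
  only \<open>M\<close> and \<open>N\<close> remain under the integral.\<close>

lemma l2_norm_le_linf_norm_h2_norm:
  fixes D :: "complex \<Rightarrow> complex ^ 'm ^ 'p" and G :: "complex \<Rightarrow> complex ^ 'm ^ 'p"
  assumes M: "continuous_on {s. 0 \<le> Re s} M" and N: "continuous_on {s. 0 \<le> Re s} N"
    and D: "\<And>s. Re s = 0 \<Longrightarrow> D s = L s ** (N s - M s ** G s)"
  shows "l2_norm D \<le> linf_norm L * (linf_norm G * h2_norm M + h2_norm N)"
proof -
  let ?l = "linf_norm L" and ?g = "linf_norm G"
  let ?m = "\<lambda>\<omega>. ennreal (norm (M (Complex 0 \<omega>)))" and ?n = "\<lambda>\<omega>. ennreal (norm (N (Complex 0 \<omega>)))"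
  note [measurable] = measurable_vertical_line[OF M order_refl] measurable_vertical_line[OF N order_refl]
  have bound: "ennreal (norm (D (Complex 0 \<omega>))) \<le> ?l * (?g * ?m \<omega> + ?n \<omega>)" for \<omega>
  proof -
    let ?s = "Complex 0 \<omega>"
    have "ennreal (norm (N ?s - M ?s ** G ?s)) \<le> ennreal (norm (M ?s ** G ?s)) + ?n \<omega>"
      using norm_triangle_ineq4[of "N ?s" "M ?s ** G ?s"]
      by (simp add: add.commute flip: ennreal_plus)
    also have "\<dots> \<le> ?g * ?m \<omega> + ?n \<omega>"
      by (intro add_right_mono order_trans[OF ennreal_norm_matrix_mult_le(2)] mult_right_mono
          sigma_max_le_linf_norm) simp
    finally have "ennreal (sigma_max (L ?s)) * ennreal (norm (N ?s - M ?s ** G ?s))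
        \<le> ?l * (?g * ?m \<omega> + ?n \<omega>)"
      by (intro mult_mono sigma_max_le_linf_norm) simp_all
    then show ?thesis
      using ennreal_norm_matrix_mult_le(1)[of "L ?s" "N ?s - M ?s ** G ?s"]
      by (simp add: D)
  qed
  have "(l2_norm D)\<^sup>2 \<le> (\<integral>\<^sup>+ \<omega>. (?l * (?g * ?m \<omega> + ?n \<omega>))\<^sup>2 \<partial>lborel)"
    unfolding l2_norm_power2 by (intro nn_integral_mono power_mono bound) simp
  also have "\<dots> = ?l\<^sup>2 * (\<integral>\<^sup>+ \<omega>. (?g * ?m \<omega> + ?n \<omega>)\<^sup>2 \<partial>lborel)"
    by (simp add: power_mult_distrib nn_integral_cmult)
  also have "\<dots> \<le> ?l\<^sup>2 * (?g * h2_norm M + h2_norm N)\<^sup>2"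
  proof (intro mult_left_mono Minkowski_nn_integral_power2)
    have "(\<integral>\<^sup>+ \<omega>. (?g * ?m \<omega>)\<^sup>2 \<partial>lborel) = ?g\<^sup>2 * (\<integral>\<^sup>+ \<omega>. (?m \<omega>)\<^sup>2 \<partial>lborel)"
      by (simp add: power_mult_distrib nn_integral_cmult)
    then show "(\<integral>\<^sup>+ \<omega>. (?g * ?m \<omega>)\<^sup>2 \<partial>lborel) \<le> (?g * h2_norm M)\<^sup>2"
      using mult_left_mono[OF nn_integral_boundary_le_h2_norm[OF M], of "?g\<^sup>2"]
      by (simp add: power_mult_distrib)
  qed (simp_all add: nn_integral_boundary_le_h2_norm N)
  finally have "(l2_norm D)\<^sup>2 \<le> (?l * (?g * h2_norm M + h2_norm N))\<^sup>2"
    by (simp add: power_mult_distrib)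
  then show ?thesis
    unfolding l2_norm_def ennreal_sqrt_power2 by (rule ennreal_sqrt_le)
qed

lemma hconcat_diff: "hconcat X Y - hconcat X' Y' = hconcat (X - X') (Y - Y')"
  by (simp add: hconcat_def vec_eq_iff split: sum.split)

lemma norm_hconcat:
  fixes X :: "complex ^ 'n::finite ^ 'p" and Y :: "complex ^ 'm::finite ^ 'p"
  shows "(norm (hconcat X Y))\<^sup>2 = (norm X)\<^sup>2 + (norm Y)\<^sup>2"
  by (simp add: norm_eq_frobenius sum_nonneg hconcat_def sum.distrib[symmetric] sum.Plus
      flip: UNIV_Plus_UNIV)

text \<open>Squared Frobenius norms add up over blocks of columns, so the concatenation dominates
  each block pointwise. This is how the gap controls both factors.\<close>

lemma h2_norm_hconcat_ge:
  fixes H :: "complex \<Rightarrow> complex ^ 'n::finite ^ 'p" and K :: "complex \<Rightarrow> complex ^ 'm::finite ^ 'p"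
  shows "h2_norm H \<le> h2_norm (\<lambda>s. hconcat (H s) (K s))"
    and "h2_norm K \<le> h2_norm (\<lambda>s. hconcat (H s) (K s))"
  by (rule h2_norm_mono, rule power2_le_imp_le; simp add: norm_hconcat)+

theorem proposition1:
  fixes A :: "real ^ 'n ^ 'n" and B :: "real ^ 'm ^ 'n" and C :: "real ^ 'n ^ 'p"
    and A' :: "real ^ 'r ^ 'r" and B' :: "real ^ 'm ^ 'r" and C' :: "real ^ 'r ^ 'p"
    and P :: "real ^ 'n ^ 'n" and P' :: "real ^ 'r ^ 'r"
    and F :: "real ^ 'p ^ 'n" and F' :: "real ^ 'p ^ 'r"
    and G G' N N' :: "complex \<Rightarrow> complex ^ 'm ^ 'p"
    and M M' :: "complex \<Rightarrow> complex ^ 'p ^ 'p"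
  assumes "stabilizable A B" and "detectable A C"
    and "stabilizable A' B'" and "detectable A' C'"
    and "mat_spectrum (cmat A) \<inter> {s. Re s = 0} = {}"
    and "mat_spectrum (cmat A') \<inter> {s. Re s = 0} = {}"
    and "riccati_solution A B C P" and "riccati_solution A' B' C' P'"
    and "F = P ** transpose C" and "F' = P' ** transpose C'"
    and "G = transfer_fun A B C" and "G' = transfer_fun A' B' C'"
    and "M = coprime_M A C F" and "N = coprime_N A B C F"
    and "M' = coprime_M A' C' F'" and "N' = coprime_N A' B' C' F'"
  shows "l2_norm (\<lambda>s. G s - G' s)
           \<le> linf_norm (\<lambda>s. matrix_inv (M' s))
              * (linf_norm G * h2_norm (\<lambda>s. M s - M' s) + h2_norm (\<lambda>s. N s - N' s))
       \<and> l2_norm (\<lambda>s. G s - G' s)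
           \<le> linf_norm (\<lambda>s. matrix_inv (M' s)) * (1 + linf_norm G)
              * h2_gap A B C F A' B' C' F'"
proof -
  have st: "asymp_stable (A - F ** C)" "asymp_stable (A' - F' ** C')"
    using assms by (auto intro: riccati_asymp_stable)
  let ?L = "linf_norm (\<lambda>s. matrix_inv (M' s))" and ?gap = "h2_gap A B C F A' B' C' F'"
  have eq: "G s - G' s = matrix_inv (M' s) ** ((N s - N' s) - (M s - M' s) ** G s)" if s: "Re s = 0" for s
  proof -
    have nin: "s \<notin> mat_spectrum (cmat A)" "s \<notin> mat_spectrum (cmat (A - F ** C))"
      "s \<notin> mat_spectrum (cmat A')" "s \<notin> mat_spectrum (cmat (A' - F' ** C'))"
      using s assms(5,6) st by (auto simp: asymp_stable_def)
    have "M s ** G s = N s" "M' s ** G' s = N' s"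
      using nin assms by (simp_all add: coprime_M_mult_transfer_fun)
    \<comment> \<open>Since \<open>M s ** G s\<close> cancels \<open>N s\<close>, what remains is
      \<open>M' s ** G s - N' s\<close>, with \<open>N' s = M' s ** G' s\<close>.\<close>
    then have "(N s - N' s) - (M s - M' s) ** G s = M' s ** (G s - G' s)"
      by (simp add: matrix_diff_ldistrib matrix_diff_rdistrib)
    moreover have "invertible (M' s)"
      using nin assms by (simp add: invertible_coprime_M)
    ultimately show ?thesis
      by (simp add: matrix_mul_assoc matrix_inv_left_inverse)
  qed
  have first: "l2_norm (\<lambda>s. G s - G' s)
      \<le> ?L * (linf_norm G * h2_norm (\<lambda>s. M s - M' s) + h2_norm (\<lambda>s. N s - N' s))"
    unfolding assms(13-16)
    by (intro l2_norm_le_linf_norm_h2_norm continuous_on_diff continuous_on_coprime_M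
        continuous_on_coprime_N st eq[unfolded assms(13-16)])
  have gap: "?gap = h2_norm (\<lambda>s. hconcat (M s - M' s) (N s - N' s))"
    by (simp add: h2_gap_def coprime_factorization_def hconcat_diff assms(13-16))
  \<comment> \<open>Both differences are blocks of the concatenation whose norm is the gap, which
    can then be factored out.\<close>
  have "?L * (linf_norm G * h2_norm (\<lambda>s. M s - M' s) + h2_norm (\<lambda>s. N s - N' s))
      \<le> ?L * (linf_norm G * ?gap + ?gap)"
    unfolding gap by (intro mult_left_mono add_mono h2_norm_hconcat_ge) simp_all
  also have "\<dots> = ?L * (1 + linf_norm G) * ?gap"
    by (simp add: distrib_left distrib_right mult.assoc add.commute)
  finally show ?thesis
    using first by (blast intro: order_trans)
qed

end
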